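(* Let $n \ge 0$ be an integer and let $a \geq 2$ be an integer. Then the only complex analytic functions $f:\mathbb{C}\to\mathbb{C}$ on $\mathbb{C}$ which are solutions of the functional equation $(E_{n,a})$, i.e. which satisfy $$f(a z) = a^{n-1} \sum_{k=0}^{a-1} f\left(z + \frac{k}{a}\right) \qquad (\forall z \in \mathbb{C}),$$ are the polynomials $\lambda B_n(X)$ with $\lambda \in \mathbb{C}$.
   Context: $B_n(X)$ ($n \ge 0$) denotes the $n$-th Bernoulli polynomial, defined by the exponential generating function $\frac{t e^{Xt}}{e^t-1} = \sum_{n=0}^{+\infty} B_n(X)\frac{t^n}{n!}$. "Analytic on $\mathbb{C}$" means entire. *)

theory Defs
  imports "HOL-Complex_Analysis.Complex_Analysis"
begin

text \<open>
  The generating function t e^(Xt) / (e^t - 1), as a formal power series in t over the ring of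
  polynomials in X. Coefficients of t / (e^t - 1) are computed over the field of complex numbers,
  where the quotient of formal power series is available, and then embedded as constant
  polynomials; the second factor is e^(Xt), the sum of the X^k t^k / k!.
\<close>
definition bernoulli_gf :: "complex poly fps" where
  "bernoulli_gf =
     Abs_fps (\<lambda>k. [:fps_nth (fps_X / (fps_exp 1 - 1)) k:]) * Abs_fps (\<lambda>k. monom (1 / fact k) k)"

definition bernoulli_poly :: "nat \<Rightarrow> complex poly" where
  "bernoulli_poly n = smult (fact n) (fps_nth bernoulli_gf n)"

lemma bernoulli_gf_eq: "bernoulli_gf = Abs_fps (\<lambda>n. smult (1 / fact n) (bernoulli_poly n))"
  by (simp add: fps_eq_iff bernoulli_poly_def)

lemma bernoulli_poly_gf_eval:
  fixes x :: complex
  shows "Abs_fps (\<lambda>n. poly (bernoulli_poly n) x / fact n) = fps_X * fps_exp x / (fps_exp 1 - 1)"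
proof -
  have nz: "fps_exp (1::complex) - 1 \<noteq> 0"
  proof
    assume "fps_exp (1::complex) - 1 = 0"
    then have "fps_nth (fps_exp (1::complex) - 1) 1 = 0" by (metis fps_zero_nth)
    then show False by simp
  qed
  have dvd: "(fps_exp (1::complex) - 1) dvd fps_X"
  proof -
    have "subdegree (fps_exp (1::complex) - 1) = 1"
      by (rule subdegreeI) auto
    then show ?thesis using nz by (simp add: fps_dvd_iff)
  qed
  have "Abs_fps (\<lambda>n. poly (bernoulli_poly n) x / fact n)
      = (fps_X / (fps_exp 1 - 1)) * fps_exp x"
    by (simp add: fps_eq_iff bernoulli_poly_def bernoulli_gf_def fps_mult_nth poly_sum poly_monom
        field_simps)
  also have "\<dots> = fps_X * fps_exp x / (fps_exp 1 - 1)"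
    using dvd by (metis dvd_div_mult)
  finally show ?thesis .
qed

end

theory Submission
  imports Defs
begin

text \<open>
  Differentiating the functional equation keeps its shape and divides the constant
  \<^term>\<open>a ^ n / a\<close> in front of the sum by \<^term>\<open>a\<close>. After \<^term>\<open>n + 1\<close> differentiations the
  constant is \<open>a\<^sup>-\<^sup>2\<close>, and a sum of \<^term>\<open>a\<close> values times \<open>a\<^sup>-\<^sup>2\<close> is at most \<open>1 / a\<close> times the largest
  of them. For \<open>\<bar>w\<bar> \<le> R\<close> and \<open>R \<ge> 1\<close> the points \<open>(w + k) / a\<close> stay in the disc of radius \<open>R\<close>, so the
  maximum of the modulus over that disc is at most \<open>1 / a\<close> times itself and therefore zero
  (\<open>continuous_solution_contractive_eq_0\<close>). One climbs back to \<^term>\<open>n\<close> by integration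
  (\<open>entire_solution_is_bernoulli_poly\<close>): Bernoulli polynomials satisfy
  \<open>B\<^sub>n\<^sub>+\<^sub>1' = (n + 1) B\<^sub>n\<close> (\<open>pderiv_bernoulli_poly_Suc\<close>), so an antiderivative of a multiple of
  \<open>B\<^sub>n\<close> is a multiple of \<open>B\<^sub>n\<^sub>+\<^sub>1\<close> up to a constant, and a nonzero constant solves the
  equation only for \<open>n = 0\<close>, where it is a multiple of \<open>B\<^sub>0 = 1\<close>.

  That \<open>B\<^sub>n\<close> itself is a solution (\<open>bernoulli_poly_multiplication\<close>) is read off the generating
  function: summing \<open>e\<^bsup>(z + k/a)t\<^esup>\<close> over \<open>k\<close> gives a geometric sum with value
  \<open>e\<^bsup>zt\<^esup> (e\<^bsup>t\<^esup> - 1) / (e\<^bsup>t/a\<^esup> - 1)\<close>.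
\<close>

section \<open>Bernoulli polynomials\<close>

lemma fps_exp_minus_1_neq_0:
  fixes c :: "'a :: field_char_0"
  assumes "c \<noteq> 0"
  shows "fps_exp c - 1 \<noteq> 0"
proof
  assume "fps_exp c - 1 = 0"
  then have "fps_nth (fps_exp c - 1) 1 = 0"
    by (metis fps_zero_nth)
  with assms show False
    by simp
qed

lemma fps_X_div_exp_minus_1_mult:
  "(fps_X / (fps_exp 1 - 1)) * (fps_exp 1 - 1) = (fps_X :: complex fps)"
proof -
  have "subdegree (fps_exp (1::complex) - 1) = 1"
    by (rule subdegreeI) auto
  then have "(fps_exp (1::complex) - 1) dvd fps_X"
    by (simp add: fps_dvd_iff fps_exp_minus_1_neq_0)
  then show ?thesis
    by simp
qed

lemma bernoulli_egf_mult:
  fixes x :: complex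
  shows "Abs_fps (\<lambda>n. poly (bernoulli_poly n) x / fact n) * (fps_exp 1 - 1) = fps_X * fps_exp x"
proof -
  have "(fps_exp (1::complex) - 1) dvd fps_X"
    using fps_X_div_exp_minus_1_mult by (metis dvd_triv_right)
  then show ?thesis
    unfolding bernoulli_poly_gf_eval by simp
qed

lemma bernoulli_poly_0: "bernoulli_poly 0 = 1"
proof -
  have "fps_nth ((fps_X / (fps_exp 1 - 1)) * (fps_exp 1 - 1)) 1 = (1 :: complex)"
    by (simp only: fps_X_div_exp_minus_1_mult) simp
  then have "fps_nth (fps_X / (fps_exp 1 - 1)) 0 = (1 :: complex)"
    by (simp add: fps_mult_nth)
  then show ?thesis
    by (simp add: bernoulli_poly_def bernoulli_gf_def fps_mult_nth monom_0 one_pCons)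
qed

text \<open>
  Differentiation in \<open>X\<close> multiplies the generating function by \<open>t\<close>, that is, it shifts the
  coefficients by one.
\<close>
lemma pderiv_bernoulli_poly_Suc:
  "pderiv (bernoulli_poly (Suc n)) = smult (of_nat (Suc n)) (bernoulli_poly n)"
proof -
  have shift: "pderiv (monom (1 / fact (Suc m)) (Suc m)) = monom (1 / fact m :: complex) m" for m
    by (simp add: pderiv_monom del: of_nat_Suc)
  define c :: "nat \<Rightarrow> complex" where "c = fps_nth (fps_X / (fps_exp 1 - 1))"
  have gf: "fps_nth bernoulli_gf m = (\<Sum>i\<le>m. smult (c i) (monom (1 / fact (m - i)) (m - i)))" for m
    by (simp add: bernoulli_gf_def fps_mult_nth c_def atLeast0AtMost)
  have "pderiv (fps_nth bernoulli_gf (Suc n))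
      = (\<Sum>i\<le>n. smult (c i) (pderiv (monom (1 / fact (Suc (n - i))) (Suc (n - i)))))"
    by (simp add: gf higher_pderiv_sum[of 1, simplified] pderiv_add pderiv_smult pderiv_pCons
        Suc_diff_le monom_0 del: fact_Suc)
  also have "\<dots> = fps_nth bernoulli_gf n"
    by (simp only: shift gf)
  finally show ?thesis
    by (simp add: bernoulli_poly_def pderiv_smult)
qed

text \<open>
  Both sides are compared through their generating functions in \<open>t\<close>: the sum over \<open>k\<close> and the
  rescaling \<open>t \<mapsto> t / a\<close> of the generating function at \<^term>\<open>a * z\<close> have, up to the factor
  \<^term>\<open>a\<close>, the same product with \<open>e\<^bsup>t/a\<^esup> - 1\<close>.
\<close>
lemma bernoulli_poly_multiplication:
  fixes z :: complex
  assumes "a > 0"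
  shows "poly (bernoulli_poly n) (of_nat a * z) =
    of_nat a powi (int n - 1) * (\<Sum>k<a. poly (bernoulli_poly n) (z + of_nat k / of_nat a))"
proof -
  define A :: complex where "A = of_nat a"
  have A: "A \<noteq> 0"
    using assms by (simp add: A_def)
  define G where "G x = Abs_fps (\<lambda>n. poly (bernoulli_poly n) x / fact n)" for x :: complex
  define e where "e = fps_exp (1 / A)"
  define S where "S = (\<Sum>k<a. G (z + of_nat k / A))"
  define T where "T = Abs_fps (\<lambda>n. (1 / A) ^ n * fps_nth (G (A * z)) n)"
  have e_pow: "e ^ k = fps_exp (of_nat k / A)" for k
    by (simp add: e_def fps_exp_power_mult)
  have e_a: "e ^ a = fps_exp 1"
    using A by (simp add: e_pow A_def)
  have e_nz: "e - 1 \<noteq> 0" and exp_nz: "fps_exp (1::complex) - 1 \<noteq> 0"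
    using A by (auto simp: e_def intro!: fps_exp_minus_1_neq_0)
  have "S * (fps_exp 1 - 1) = (\<Sum>k<a. fps_X * fps_exp z * e ^ k)"
    by (simp add: S_def G_def sum_distrib_right bernoulli_egf_mult fps_exp_add_mult e_pow mult.assoc)
  also have "\<dots> = fps_X * fps_exp z * (\<Sum>k<a. e ^ k)"
    by (simp add: sum_distrib_left)
  finally have "(S * (e - 1)) * (fps_exp 1 - 1)
      = fps_X * fps_exp z * ((e - 1) * (\<Sum>k<a. e ^ k))"
    by (simp add: mult_ac)
  also have "(e - 1) * (\<Sum>k<a. e ^ k) = fps_exp 1 - 1"
    using power_diff_1_eq[of e a] e_a by simp
  finally have S: "S * (e - 1) = fps_X * fps_exp z"
    using exp_nz by simp
  have T_comp: "T = G (A * z) oo (fps_const (1 / A) * fps_X)"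
    by (simp add: T_def fps_compose_linear)
  have "(G (A * z) * (fps_exp 1 - 1)) oo (fps_const (1 / A) * fps_X)
      = (fps_X * fps_exp (A * z)) oo (fps_const (1 / A) * fps_X)"
    by (simp add: G_def bernoulli_egf_mult)
  then have "T * (e - 1) = fps_const (1 / A) * fps_X * fps_exp z"
    using A by (simp add: fps_compose_mult_distrib fps_compose_sub_distrib T_comp e_def)
  then have "(fps_const A * T) * (e - 1) = fps_X * fps_exp z"
    using A by (simp add: mult.assoc)
  with S e_nz have "S = fps_const A * T"
    by (metis mult_right_cancel)
  then have "fps_nth S n = A * ((1 / A) ^ n * fps_nth (G (A * z)) n)"
    by (simp add: T_def)
  moreover have "fps_nth S n = (\<Sum>k<a. poly (bernoulli_poly n) (z + of_nat k / A)) / fact n"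
    by (simp add: S_def G_def fps_sum_nth sum_divide_distrib)
  ultimately have "(\<Sum>k<a. poly (bernoulli_poly n) (z + of_nat k / A))
      = A * (1 / A) ^ n * poly (bernoulli_poly n) (A * z)"
    by (simp add: G_def)
  then show ?thesis
    using A by (simp add: power_int_diff A_def field_simps)
qed

section \<open>The functional equation for entire functions\<close>

text \<open>
  The factor in front of the sum is a free parameter \<^term>\<open>c\<close>, because differentiation changes it.
\<close>
definition multiplication_eq :: "nat \<Rightarrow> complex \<Rightarrow> (complex \<Rightarrow> complex) \<Rightarrow> bool" where
  "multiplication_eq a c f \<longleftrightarrow>
     (\<forall>z. f (of_nat a * z) = c * (\<Sum>k<a. f (z + of_nat k / of_nat a)))"

lemma multiplication_eq_diff:
  assumes "multiplication_eq a c f" "multiplication_eq a c g"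
  shows "multiplication_eq a c (\<lambda>z. f z - g z)"
  using assms by (simp add: multiplication_eq_def sum_subtractf right_diff_distrib)

lemma multiplication_eq_mult:
  assumes "multiplication_eq a c f"
  shows "multiplication_eq a c (\<lambda>z. b * f z)"
  using assms by (simp add: multiplication_eq_def sum_distrib_left mult_ac)

lemma multiplication_eq_const_iff:
  "multiplication_eq a c (\<lambda>_. b) \<longleftrightarrow> b = 0 \<or> c * of_nat a = 1"
  by (auto simp: multiplication_eq_def mult_ac)

lemma multiplication_eq_deriv:
  assumes f: "f holomorphic_on UNIV" and eq: "multiplication_eq a c f" and "a > 0"
  shows "multiplication_eq a (c / of_nat a) (deriv f)"
  unfolding multiplication_eq_def
proof
  fix z :: complex
  have D: "(f has_field_derivative deriv f w) (at w)" for w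
    using f by (simp add: holomorphic_derivI)
  have "((\<lambda>z. f (of_nat a * z)) has_field_derivative deriv f (of_nat a * z) * of_nat a) (at z)"
    by (rule DERIV_chain2[OF D]) (auto intro!: derivative_eq_intros)
  moreover have "((\<lambda>z. c * (\<Sum>k<a. f (z + of_nat k / of_nat a))) has_field_derivative
      c * (\<Sum>k<a. deriv f (z + of_nat k / of_nat a) * 1)) (at z)"
    by (intro DERIV_cmult DERIV_sum DERIV_chain2[OF D]) (auto intro!: derivative_eq_intros)
  moreover have "(\<lambda>z. f (of_nat a * z)) = (\<lambda>z. c * (\<Sum>k<a. f (z + of_nat k / of_nat a)))"
    using eq by (auto simp: multiplication_eq_def)
  ultimately have "deriv f (of_nat a * z) * of_nat a
      = c * (\<Sum>k<a. deriv f (z + of_nat k / of_nat a))"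
    by (auto dest: DERIV_unique)
  with \<open>a > 0\<close> show "deriv f (of_nat a * z)
      = c / of_nat a * (\<Sum>k<a. deriv f (z + of_nat k / of_nat a))"
    by (simp add: field_simps)
qed

text \<open>
  Let \<open>w\<^sub>0\<close> maximise \<open>\<bar>f\<bar>\<close> on the closed disc of radius \<open>R \<ge> 1\<close>. The equation expresses \<open>f w\<^sub>0\<close> by
  the values of \<open>f\<close> at the points \<open>(w\<^sub>0 + k) / a\<close>, which lie in the same disc because
  \<open>(R + a - 1) / a \<le> R\<close>; hence \<open>\<bar>f w\<^sub>0\<bar> \<le> \<bar>c\<bar> a \<bar>f w\<^sub>0\<bar>\<close>.
\<close>
lemma continuous_solution_contractive_eq_0:
  assumes cont: "continuous_on UNIV f" and eq: "multiplication_eq a c f"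
    and "a > 0" and small: "norm c * real a < 1"
  shows "f z = 0"
proof -
  define R where "R = max 1 (norm z)"
  have R: "R \<ge> 1" "z \<in> cball 0 R"
    by (auto simp: R_def)
  have "continuous_on (cball 0 R) (\<lambda>w. norm (f w))"
    using cont by (intro continuous_intros) (rule continuous_on_subset, auto)
  then obtain w0 where w0: "w0 \<in> cball 0 R"
    and max: "\<And>w. w \<in> cball 0 R \<Longrightarrow> norm (f w) \<le> norm (f w0)"
    using continuous_attains_sup[of "cball 0 R" "\<lambda>w. norm (f w)"] R by auto
  have "norm (f (w0 / of_nat a + of_nat k / of_nat a)) \<le> norm (f w0)" if "k < a" for k
  proof (rule max)
    have "norm (w0 + of_nat k) \<le> R + real k"
      using w0 norm_triangle_ineq[of w0 "of_nat k"] by simp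
    also have "\<dots> \<le> R + (real a - 1) * R"
    proof -
      have "real k \<le> real a - 1"
        using that by linarith
      also have "\<dots> \<le> (real a - 1) * R"
        using mult_left_mono[OF R(1), of "real a - 1"] \<open>a > 0\<close> by simp
      finally show ?thesis
        by simp
    qed
    finally have "norm (w0 + of_nat k) \<le> real a * R"
      by (simp add: algebra_simps)
    then show "w0 / of_nat a + of_nat k / of_nat a \<in> cball 0 R"
      using \<open>a > 0\<close> by (simp add: add_divide_distrib[symmetric] norm_divide field_simps)
  qed
  then have "norm (\<Sum>k<a. f (w0 / of_nat a + of_nat k / of_nat a)) \<le> real a * norm (f w0)"
    using sum_norm_bound[of "{..<a}" "\<lambda>k. f (w0 / of_nat a + of_nat k / of_nat a)"] by simp
  then have "norm c * norm (\<Sum>k<a. f (w0 / of_nat a + of_nat k / of_nat a))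
      \<le> norm c * (real a * norm (f w0))"
    by (intro mult_left_mono) auto
  moreover have "f (of_nat a * (w0 / of_nat a))
      = c * (\<Sum>k<a. f (w0 / of_nat a + of_nat k / of_nat a))"
    using eq unfolding multiplication_eq_def by blast
  ultimately have le: "norm (f w0) \<le> (norm c * real a) * norm (f w0)"
    using \<open>a > 0\<close> by (simp add: norm_mult mult_ac)
  have "norm (f w0) = 0"
  proof (rule ccontr)
    assume "norm (f w0) \<noteq> 0"
    with small have "(norm c * real a) * norm (f w0) < 1 * norm (f w0)"
      by (intro mult_strict_right_mono) auto
    with le show False
      by simp
  qed
  with max[OF R(2)] show ?thesis
    by simp
qed

lemma multiplication_eq_bernoulli_poly:
  assumes "a > 0"
  shows "multiplication_eq a (of_nat a powi (int n - 1)) (poly (bernoulli_poly n))"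
  using bernoulli_poly_multiplication[OF assms] by (simp add: multiplication_eq_def)

lemma holomorphic_zero_deriv_constant:
  assumes "f holomorphic_on UNIV" "\<And>z. deriv f z = 0"
  obtains b where "f = (\<lambda>_. b)"
proof -
  have "(f has_field_derivative 0) (at z within UNIV)" for z
    using holomorphic_derivI[OF assms(1), of z] assms(2) by simp
  then obtain b where "\<forall>z\<in>UNIV. f z = b"
    using has_field_derivative_zero_constant[of UNIV f] by auto
  with that show ?thesis
    by auto
qed

text \<open>
  Induction on \<^term>\<open>n\<close>: the derivative of a solution for \<^term>\<open>Suc n\<close> is a solution for \<^term>\<open>n\<close>,
  hence a multiple of \<open>B\<^sub>n\<close>, and integrating leaves only an additive constant to be excluded.
\<close>
lemma entire_solution_is_bernoulli_poly:
  assumes "a \<ge> 2" "f holomorphic_on UNIV" "multiplication_eq a (of_nat a powi (int n - 1)) f"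
  shows "\<exists>b. f = poly (smult b (bernoulli_poly n))"
  using assms(2,3)
proof (induction n arbitrary: f)
  case 0
  \<comment> \<open>For the derivative the constant is \<open>a\<^sup>-\<^sup>2\<close>, and \<open>a\<^sup>-\<^sup>2 \<cdot> a < 1\<close>.\<close>
  have "multiplication_eq a (of_nat a powi (-1) / of_nat a) (deriv f)"
    using multiplication_eq_deriv[OF 0(1)] 0(2) \<open>a \<ge> 2\<close> by simp
  moreover have "norm (of_nat a powi (-1) / of_nat a :: complex) * real a < 1"
    using \<open>a \<ge> 2\<close> by (simp add: norm_divide norm_mult norm_inverse field_simps)
  moreover have "continuous_on UNIV (deriv f)"
    using 0(1) by (intro holomorphic_on_imp_continuous_on holomorphic_deriv) auto
  ultimately have "deriv f z = 0" for z
    using \<open>a \<ge> 2\<close> by (intro continuous_solution_contractive_eq_0) auto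
  then obtain b where "f = (\<lambda>_. b)"
    using holomorphic_zero_deriv_constant[OF 0(1)] by blast
  then show ?case
    by (auto simp: bernoulli_poly_0 fun_eq_iff)
next
  case (Suc n)
  have a: "a > 0"
    using \<open>a \<ge> 2\<close> by simp
  have "of_nat a powi (int (Suc n) - 1) / of_nat a = (of_nat a powi (int n - 1) :: complex)"
    using a by (simp add: power_int_diff)
  then have "multiplication_eq a (of_nat a powi (int n - 1)) (deriv f)"
    using multiplication_eq_deriv[OF Suc.prems a] by simp
  moreover have "deriv f holomorphic_on UNIV"
    using Suc.prems(1) by (intro holomorphic_deriv) auto
  ultimately obtain b where b: "deriv f = poly (smult b (bernoulli_poly n))"
    using Suc.IH by blast
  define b' where "b' = b / of_nat (Suc n)"
  define g where "g z = f z - b' * poly (bernoulli_poly (Suc n)) z" for z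
  have g_hol: "g holomorphic_on UNIV"
    unfolding g_def using Suc.prems(1) by (intro holomorphic_intros) auto
  have "deriv g z = 0" for z
  proof (rule DERIV_imp_deriv)
    have "(g has_field_derivative
        deriv f z - b' * poly (pderiv (bernoulli_poly (Suc n))) z) (at z)"
      unfolding g_def using Suc.prems(1)
      by (intro DERIV_diff DERIV_cmult poly_DERIV) (simp add: holomorphic_derivI)
    then show "(g has_field_derivative 0) (at z)"
      by (simp add: b b'_def pderiv_bernoulli_poly_Suc del: of_nat_Suc)
  qed
  then obtain d where d: "g = (\<lambda>_. d)"
    using holomorphic_zero_deriv_constant[OF g_hol] by blast
  have "multiplication_eq a (of_nat a powi (int (Suc n) - 1)) g"
    unfolding g_def
    by (intro multiplication_eq_diff multiplication_eq_mult multiplication_eq_bernoulli_poly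
        Suc.prems a)
  moreover have "of_nat a powi (int (Suc n) - 1) * of_nat a \<noteq> (1 :: complex)"
  proof -
    have "of_nat a powi (int (Suc n) - 1) * of_nat a = (of_nat (a ^ Suc n) :: complex)"
      by simp
    moreover have "a ^ Suc n \<noteq> 1"
      using \<open>a \<ge> 2\<close> by (metis One_nat_def nat_power_eq_Suc_0_iff not_less_eq_eq numeral_2_eq_2
          order_refl nat.distinct(1))
    ultimately show ?thesis
      by (metis of_nat_eq_1_iff)
  qed
  ultimately have "d = 0"
    by (simp add: d multiplication_eq_const_iff)
  then have "f z = poly (smult b' (bernoulli_poly (Suc n))) z" for z
    using fun_cong[OF d, of z] by (simp add: g_def)
  then show ?case
    by blast
qed

theorem theorem3p2:
  fixes n a :: nat and f :: "complex \<Rightarrow> complex"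
  assumes "a \<ge> 2"
  shows "(f analytic_on UNIV \<and>
          (\<forall>z. f (of_nat a * z) =
             of_nat a powi (int n - 1) * (\<Sum>k<a. f (z + of_nat k / of_nat a))))
     \<longleftrightarrow> (\<exists>c. f = poly (smult c (bernoulli_poly n)))"
proof (intro iffI conjI)
  assume "f analytic_on UNIV \<and>
    (\<forall>z. f (of_nat a * z) = of_nat a powi (int n - 1) * (\<Sum>k<a. f (z + of_nat k / of_nat a)))"
  then have "f holomorphic_on UNIV" "multiplication_eq a (of_nat a powi (int n - 1)) f"
    by (simp_all add: analytic_on_open multiplication_eq_def)
  with assms show "\<exists>c. f = poly (smult c (bernoulli_poly n))"
    by (rule entire_solution_is_bernoulli_poly)
next
  assume "\<exists>c. f = poly (smult c (bernoulli_poly n))"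
  then obtain c where f: "f = (\<lambda>z. c * poly (bernoulli_poly n) z)"
    by (auto simp: fun_eq_iff)
  show "f analytic_on UNIV"
    unfolding f by (simp add: analytic_on_open holomorphic_intros)
  have "multiplication_eq a (of_nat a powi (int n - 1)) f"
    unfolding f using assms by (intro multiplication_eq_mult multiplication_eq_bernoulli_poly) auto
  then show "\<forall>z. f (of_nat a * z)
      = of_nat a powi (int n - 1) * (\<Sum>k<a. f (z + of_nat k / of_nat a))"
    by (simp add: multiplication_eq_def)
qed

end
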